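(* Let $\beta>0$ and $\lambda_0\in(0,1/\beta)$, and let $(\lambda_n)_{n\ge 0}$ be the real sequence defined by $\lambda_{n+1}=\lambda_n(1-\beta\lambda_n)$ for $n=0,1,2,\ldots$. Define, for $n\ge 0$, $$\lambda_n^{\ell}=\frac{\lambda_0}{1+\frac{\beta\lambda_0}{1-\beta\lambda_0}\,n},\qquad \lambda_n^{u}=\frac{\lambda_0}{1+\beta\lambda_0\,n},$$ which satisfy $\lambda_n^{\ell}\sim\frac{1-\beta\lambda_0}{\beta n}$ and $\lambda_n^{u}\sim\frac{1}{\beta n}$ as $n\to\infty$. Then, for all $n\ge 0$, $$\lambda_n^{\ell}\le\lambda_n\le\lambda_n^{u}.$$
   Context: For positive sequences, $a_n\sim b_n$ as $n\to\infty$ means $a_n/b_n\to 1$. *)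

theory Defs
  imports Complex_Main "HOL-Library.Landau_Symbols"
begin

definition lower_seq :: "real \<Rightarrow> real \<Rightarrow> nat \<Rightarrow> real" where
  "lower_seq \<beta> l0 n = l0 / (1 + \<beta> * l0 / (1 - \<beta> * l0) * real n)"

definition upper_seq :: "real \<Rightarrow> real \<Rightarrow> nat \<Rightarrow> real" where
  "upper_seq \<beta> l0 n = l0 / (1 + \<beta> * l0 * real n)"

end

(* The reciprocals satisfy 1 / l (n+1) = 1 / l n + \<beta> / (1 - \<beta> * l n), and since 0 < l n \<le> l 0 the
   increment lies between \<beta> and \<beta> / (1 - \<beta> * l 0); summing these bounds gives both inequalities. *)
theory Submission
  imports Defs "HOL-Real_Asymp.Real_Asymp"
begin

text \<open>Both bounding sequences have the form on the left, so this gives both asymptotic claims: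
  for \<open>c > 0\<close> the summand 1 is negligible against \<open>c * real n\<close>.\<close>

lemma hyperbola_asymp_equiv:
  fixes a c :: real
  assumes "c > 0"
  shows "(\<lambda>n. a / (1 + c * real n)) \<sim>[sequentially] (\<lambda>n. a / (c * real n))"
proof -
  have "(\<lambda>n. 1 + c * real n) \<sim>[sequentially] (\<lambda>n. c * real n)"
    using assms by real_asymp
  then show ?thesis
    by (intro asymp_equiv_intros)
qed

context
  fixes \<beta> :: real and l :: "nat \<Rightarrow> real"
  assumes \<beta>: "\<beta> > 0"
    and l0: "0 < l 0" "\<beta> * l 0 < 1"
    and l_Suc: "\<And>n. l (Suc n) = l n * (1 - \<beta> * l n)"
begin

text \<open>As long as \<open>l n \<le> l 0\<close>, the factor \<open>1 - \<beta> * l n\<close>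
  lies in (0, 1], so a step keeps the sequence positive and does not increase it.\<close>

lemma iterate_bounds: "0 < l n \<and> l n \<le> l 0"
proof (induction n)
  case 0
  then show ?case using l0 by simp
next
  case (Suc n)
  have "\<beta> * l n \<le> \<beta> * l 0"
    using Suc \<beta> by simp
  then have "0 < 1 - \<beta> * l n" "1 - \<beta> * l n \<le> 1"
    using l0 mult_pos_pos[OF \<beta>, of "l n"] Suc by linarith+
  then have "0 < l (Suc n)" "l (Suc n) \<le> l n"
    unfolding l_Suc using Suc mult_left_le[of "1 - \<beta> * l n" "l n"] by auto
  then show ?case using Suc by simp
qed

lemma reciprocal_bounds:
  "1 / l 0 + \<beta> * real n \<le> 1 / l n \<and> 1 / l n \<le> 1 / l 0 + \<beta> / (1 - \<beta> * l 0) * real n"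
proof (induction n)
  case 0
  then show ?case by simp
next
  case (Suc n)
  have pos: "0 < l n"
    using iterate_bounds by blast
  have ge: "1 - \<beta> * l n \<ge> 1 - \<beta> * l 0"
    using iterate_bounds[of n] \<beta> by simp
  then have lt: "1 - \<beta> * l n > 0"
    using l0 by linarith
  \<comment> \<open>Partial fractions: 1 / (x (1 - \<beta> x)) = 1 / x + \<beta> / (1 - \<beta> x),
    with x = \<open>l n\<close>.\<close>
  have step: "1 / l (Suc n) = 1 / l n + \<beta> / (1 - \<beta> * l n)"
    unfolding l_Suc using pos lt by (simp add: divide_simps)
  have "\<beta> \<le> \<beta> / (1 - \<beta> * l n)"
    using pos lt \<beta> by (simp add: pos_le_divide_eq mult_left_le)
  moreover have "\<beta> / (1 - \<beta> * l n) \<le> \<beta> / (1 - \<beta> * l 0)"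
    by (intro divide_left_mono mult_pos_pos ge lt) (use l0 \<beta> in auto)
  ultimately show ?case
    using Suc unfolding step by (simp add: distrib_left)
qed

text \<open>The reciprocal of \<open>upper_seq \<beta> (l 0) n\<close> is
  \<open>1 / l 0 + \<beta> * real n\<close>; inverting positive quantities turns the lower bound on
  \<open>1 / l n\<close> into an upper bound on \<open>l n\<close>.\<close>

lemma upper_bound: "l n \<le> upper_seq \<beta> (l 0) n"
proof -
  have "(1 + \<beta> * l 0 * real n) / l 0 \<le> 1 / l n"
    using reciprocal_bounds[of n] l0 by (simp add: field_simps)
  moreover have "0 < 1 + \<beta> * l 0 * real n"
    using \<beta> l0 by (simp add: add_pos_nonneg)
  ultimately show ?thesis
    using iterate_bounds[of n] l0 unfolding upper_seq_def
    by (simp add: divide_simps mult.commute)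
qed

lemma lower_bound: "lower_seq \<beta> (l 0) n \<le> l n"
proof -
  \<comment> \<open>Keeping the slope opaque prevents \<open>divide_simps\<close> from clearing the
    inner denominator \<open>1 - \<beta> * l 0\<close>.\<close>
  define c where "c = \<beta> / (1 - \<beta> * l 0)"
  have "1 / l n \<le> (1 + c * l 0 * real n) / l 0"
    using reciprocal_bounds[of n] l0 by (simp add: c_def[symmetric] add_divide_distrib)
  moreover have "0 < 1 + c * l 0 * real n"
    using \<beta> l0 by (simp add: c_def add_pos_nonneg)
  ultimately have "l 0 / (1 + c * l 0 * real n) \<le> l n"
    using iterate_bounds[of n] l0 by (simp add: divide_simps mult.commute)
  then show ?thesis
    by (simp add: lower_seq_def c_def)
qed

end

theorem theorem1:
  fixes \<beta> :: real and l :: "nat \<Rightarrow> real"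
  assumes "\<beta> > 0"
    and "l 0 \<in> {0<..<1 / \<beta>}"
    and "\<And>n. l (Suc n) = l n * (1 - \<beta> * l n)"
  shows "lower_seq \<beta> (l 0) \<sim>[sequentially] (\<lambda>n. (1 - \<beta> * l 0) / (\<beta> * real n)) \<and>
         upper_seq \<beta> (l 0) \<sim>[sequentially] (\<lambda>n. 1 / (\<beta> * real n)) \<and>
         (\<forall>n. lower_seq \<beta> (l 0) n \<le> l n \<and> l n \<le> upper_seq \<beta> (l 0) n)"
proof (intro conjI allI)
  have l0: "0 < l 0" "\<beta> * l 0 < 1"
    using assms(1,2) by (auto simp: field_simps)
  \<comment> \<open>The factor \<open>l 0\<close> cancels. The functions agree at n = 0 too, where
    division by zero makes both values 0.\<close>
  have "(\<lambda>n. l 0 / (\<beta> * l 0 / (1 - \<beta> * l 0) * real n)) = (\<lambda>n. (1 - \<beta> * l 0) / (\<beta> * real n))"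
    using l0 by auto
  then show "lower_seq \<beta> (l 0) \<sim>[sequentially] (\<lambda>n. (1 - \<beta> * l 0) / (\<beta> * real n))"
    using hyperbola_asymp_equiv[of "\<beta> * l 0 / (1 - \<beta> * l 0)" "l 0"] l0 assms(1)
    \<comment> \<open>Without the deletion, simp would move \<open>real n\<close> into the numerator
      of the slope, and the terms would lose the form c n.\<close>
    by (simp del: times_divide_eq_left add: lower_seq_def[abs_def])
  have "(\<lambda>n. l 0 / (\<beta> * l 0 * real n)) = (\<lambda>n. 1 / (\<beta> * real n))"
    using l0 by auto
  then show "upper_seq \<beta> (l 0) \<sim>[sequentially] (\<lambda>n. 1 / (\<beta> * real n))"
    using hyperbola_asymp_equiv[of "\<beta> * l 0" "l 0"] l0 assms(1)
    by (simp add: upper_seq_def[abs_def])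
  show "lower_seq \<beta> (l 0) n \<le> l n" "l n \<le> upper_seq \<beta> (l 0) n" for n
    using lower_bound[of \<beta> l n] upper_bound[of \<beta> l n] assms(1,3) l0 by auto
qed

end
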